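(* Let $R$ be an order in $K$. For every over-order $S$ of $R$, the action of $\mathrm{Pic}(S)$ on $\mathrm{ICM}_S(R)$ induced by ideal multiplication is free, and $$\mathcal{W}_S(R)=\mathrm{ICM}_S(R)/\mathrm{Pic}(S)$$ (that is, two classes $\{I\},\{I'\}\in \mathrm{ICM}_S(R)$ lie in the same $\mathrm{Pic}(S)$-orbit if and only if $[I]=[I']$). More concretely, if $$\mathcal{W}_S(R)=\{[I_1],\ldots,[I_r]\}\quad\text{and}\quad \mathrm{Pic}(S)=\{\{J_1\},\ldots,\{J_s\}\},$$ with the $I_i$'s pairwise not weakly equivalent and the $J_j$'s pairwise not isomorphic, then $$\mathrm{ICM}_S(R)=\{\{I_iJ_j\} : 1\le i\le r,\ 1\le j\le s\}$$ and the fractional ideals $I_iJ_j$ are pairwise not isomorphic.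
   Context: An order is a commutative reduced ring $R$ with unit that is free and finitely generated as a $\mathbb{Z}$-module; its total quotient ring $K$ is a finite product of number fields, and $R$ is called an order in $K$. A fractional $R$-ideal is a finitely generated sub-$R$-module $I$ of $K$ with $I\otimes_{\mathbb{Z}}\mathbb{Q}=K$ (i.e. $I$ spans $K$ over $\mathbb{Q}$). For fractional $R$-ideals $I,J$, $IJ$ is the usual product and $(I:J)=\{x\in K: xJ\subseteq I\}$. An over-order of $R$ is a fractional $R$-ideal that is a subring of $K$ (so it contains $R$). The multiplicator ring of $I$ is $(I:I)$, which is an over-order of $R$. A fractional $R$-ideal $I$ is invertible if $IJ=R$ for some fractional $R$-ideal $J$. Two fractional $R$-ideals are isomorphic (as $R$-modules) if and only if $I=\alpha J$ for some $\alpha\in K^\times$; the isomorphism class of $I$ is denoted $\{I\}$. $\mathrm{ICM}(R)$ is the commutative monoid (under ideal multiplication) of isomorphism classes of fractional $R$-ideals, and $\mathrm{Pic}(S)$ is the group of isomorphism classes of invertible fractional $S$-ideals. Two fractional $R$-ideals $I,J$ are weakly equivalent if they satisfy the following equivalent conditions: $I_{\mathfrak p}\simeq J_{\mathfrak p}$ as $R_{\mathfrak p}$-modules for every maximal ideal $\mathfrak p$ of $R$; $1\in (I:J)(J:I)$; $I$ and $J$ have the same multiplicator ring $S$ and $I=LJ$ for some invertible fractional $S$-ideal $L$. The weak equivalence class of $I$ is denoted $[I]$. For an over-order $S$ of $R$, $\mathrm{ICM}_S(R)$ is the set of isomorphism classes $\{I\}$ of fractional $R$-ideals with $(I:I)=S$,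 and $\mathcal{W}_S(R)$ is the set of weak equivalence classes $[I]$ of fractional $R$-ideals with $(I:I)=S$. *)

theory Defs
  imports Complex_Main "HOL-Algebra.Group_Action"
begin

text \<open>
  The total quotient ring \<open>K\<close> is the whole of a type \<open>'k\<close> of class \<open>comm_ring_1\<close>; orders,
  over-orders and fractional ideals are subsets of it.
\<close>

section \<open>Orders\<close>

definition is_subring :: "'k::comm_ring_1 set \<Rightarrow> bool" where
  "is_subring R \<longleftrightarrow> 1 \<in> R \<and> (\<forall>x\<in>R. \<forall>y\<in>R. x - y \<in> R \<and> x * y \<in> R)"

definition is_reduced :: "'k::comm_ring_1 set \<Rightarrow> bool" where
  "is_reduced R \<longleftrightarrow> (\<forall>x\<in>R. \<forall>n::nat. x ^ n = 0 \<longrightarrow> x = 0)"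

definition int_scale :: "int \<Rightarrow> 'k::comm_ring_1 \<Rightarrow> 'k" where
  "int_scale n x = of_int n * x"

text \<open>Free and finitely generated over the integers: there is a finite basis.\<close>

definition is_fg_free_int_module :: "'k::comm_ring_1 set \<Rightarrow> bool" where
  "is_fg_free_int_module R \<longleftrightarrow>
     (\<exists>B. finite B \<and> \<not> module.dependent int_scale B \<and> module.span int_scale B = R)"

definition non_zero_divisor :: "'k::comm_ring_1 set \<Rightarrow> 'k \<Rightarrow> bool" where
  "non_zero_divisor R s \<longleftrightarrow> s \<in> R \<and> (\<forall>y\<in>R. s * y = 0 \<longrightarrow> y = 0)"

text \<open>The ambient type is the total quotient ring of \<open>R\<close>, that is, the localization of \<open>R\<close> at
  its non-zero-divisors.\<close>

definition is_total_quotient_ring_of :: "'k::comm_ring_1 set \<Rightarrow> bool" where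
  "is_total_quotient_ring_of R \<longleftrightarrow>
     (\<forall>s. non_zero_divisor R s \<longrightarrow> s dvd 1) \<and>
     (\<forall>x. \<exists>r\<in>R. \<exists>s. non_zero_divisor R s \<and> s * x = r)"

definition is_order :: "'k::comm_ring_1 set \<Rightarrow> bool" where
  "is_order R \<longleftrightarrow> is_subring R \<and> is_reduced R \<and> is_fg_free_int_module R \<and>
     is_total_quotient_ring_of R"

section \<open>Fractional ideals\<close>

definition is_submodule :: "'k::comm_ring_1 set \<Rightarrow> 'k set \<Rightarrow> bool" where
  "is_submodule R I \<longleftrightarrow> 0 \<in> I \<and> (\<forall>x\<in>I. \<forall>y\<in>I. x + y \<in> I) \<and> (\<forall>r\<in>R. \<forall>x\<in>I. r * x \<in> I)"

definition is_finitely_generated :: "'k::comm_ring_1 set \<Rightarrow> 'k set \<Rightarrow> bool" where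
  "is_finitely_generated R I \<longleftrightarrow>
     (\<exists>G. finite G \<and> G \<subseteq> I \<and> I = {\<Sum>g\<in>G. c g * g | c. \<forall>g\<in>G. c g \<in> R})"

text \<open>For an additive subgroup \<open>I\<close>, the elements of the rational span of \<open>I\<close> are exactly the
  fractions \<open>y / n\<close> with \<open>y \<in> I\<close> and \<open>n\<close> a positive integer (common denominator).\<close>

definition spans_over_rationals :: "'k::comm_ring_1 set \<Rightarrow> bool" where
  "spans_over_rationals I \<longleftrightarrow> (\<forall>x. \<exists>y\<in>I. \<exists>n::nat. n > 0 \<and> of_nat n * x = y)"

definition fractional_ideal :: "'k::comm_ring_1 set \<Rightarrow> 'k set \<Rightarrow> bool" where
  "fractional_ideal R I \<longleftrightarrow>
     is_submodule R I \<and> is_finitely_generated R I \<and> spans_over_rationals I"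

definition ideal_mult :: "'k::comm_ring_1 set \<Rightarrow> 'k set \<Rightarrow> 'k set" where
  "ideal_mult I J =
     {\<Sum>i<n. x i * y i | (n::nat) x y. \<forall>i<n. x i \<in> I \<and> y i \<in> J}"

definition colon :: "'k::comm_ring_1 set \<Rightarrow> 'k set \<Rightarrow> 'k set" where
  "colon I J = {x. \<forall>y\<in>J. x * y \<in> I}"

definition multiplicator_ring :: "'k::comm_ring_1 set \<Rightarrow> 'k set" where
  "multiplicator_ring I = colon I I"

definition over_order :: "'k::comm_ring_1 set \<Rightarrow> 'k set \<Rightarrow> bool" where
  "over_order R S \<longleftrightarrow> fractional_ideal R S \<and> is_subring S"

definition invertible_ideal :: "'k::comm_ring_1 set \<Rightarrow> 'k set \<Rightarrow> bool" where
  "invertible_ideal R I \<longleftrightarrow>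
     fractional_ideal R I \<and> (\<exists>J. fractional_ideal R J \<and> ideal_mult I J = R)"

section \<open>Isomorphism and weak equivalence\<close>

definition ideal_iso :: "'k::comm_ring_1 set \<Rightarrow> 'k set \<Rightarrow> 'k set \<Rightarrow> bool" where
  "ideal_iso R I J \<longleftrightarrow>
     (\<exists>f. bij_betw f I J \<and> (\<forall>x\<in>I. \<forall>y\<in>I. f (x + y) = f x + f y) \<and>
        (\<forall>r\<in>R. \<forall>x\<in>I. f (r * x) = r * f x))"

definition iso_class :: "'k::comm_ring_1 set \<Rightarrow> 'k set \<Rightarrow> 'k set set" where
  "iso_class R I = {J. fractional_ideal R J \<and> ideal_iso R I J}"

text \<open>Among the equivalent descriptions of weak equivalence, the global one
  \<open>1 \<in> (I : J)(J : I)\<close> is the one that needs no localization.\<close>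

definition weakly_equivalent :: "'k::comm_ring_1 set \<Rightarrow> 'k set \<Rightarrow> bool" where
  "weakly_equivalent I J \<longleftrightarrow> 1 \<in> ideal_mult (colon I J) (colon J I)"

definition weak_class :: "'k::comm_ring_1 set \<Rightarrow> 'k set \<Rightarrow> 'k set set" where
  "weak_class R I = {J. fractional_ideal R J \<and> weakly_equivalent I J}"

definition ICM_at :: "'k::comm_ring_1 set \<Rightarrow> 'k set \<Rightarrow> 'k set set set" where
  "ICM_at R S = {iso_class R I | I. fractional_ideal R I \<and> multiplicator_ring I = S}"

definition W_at :: "'k::comm_ring_1 set \<Rightarrow> 'k set \<Rightarrow> 'k set set set" where
  "W_at R S = {weak_class R I | I. fractional_ideal R I \<and> multiplicator_ring I = S}"

section \<open>The Picard group and its action\<close>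

text \<open>Multiplication of classes by representatives. The union is over all choices of
  representatives, which all contribute the same class.\<close>

definition class_mult ::
  "'k::comm_ring_1 set \<Rightarrow> 'k set set \<Rightarrow> 'k set set \<Rightarrow> 'k set set" where
  "class_mult R X Y = (\<Union>I\<in>X. \<Union>J\<in>Y. iso_class R (ideal_mult I J))"

definition Pic :: "'k::comm_ring_1 set \<Rightarrow> 'k set set monoid" where
  "Pic S = \<lparr>carrier = {iso_class S J | J. invertible_ideal S J},
            mult = class_mult S, one = iso_class S S\<rparr>"

text \<open>The restriction to \<open>ICM_at R S\<close> is needed because group actions in the library map
  into extensional functions.\<close>

definition Pic_action ::
  "'k::comm_ring_1 set \<Rightarrow> 'k set \<Rightarrow> 'k set set \<Rightarrow> 'k set set \<Rightarrow> 'k set set" where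
  "Pic_action R S X = (\<lambda>Y\<in>ICM_at R S. class_mult R X Y)"

end

(* A linear map between fractional ideals is multiplication by a unit of the total quotient ring,
   so the isomorphism class of I is {aI | a a unit}, over R and over S alike. If
   1 is in (I : I')(I' : I), then (I : I') is invertible with inverse (I' : I) and I = (I : I') I';
   hence the weak equivalence class of I is {JI | J invertible}, the union of the orbit of I.
   The action is free because JI = LI implies L^-1 J I = I, so L^-1 J is contained in
   (I : I) = S and J in L, and symmetrically L in J. *)
theory Submission
  imports Defs
begin

section \<open>Products of additive subsets\<close>

text \<open>Two coefficient rings are in play: \<open>Pic S\<close> classifies S-ideals up to
  S-isomorphism, \<open>ICM_at R S\<close> classifies R-ideals up to R-isomorphism. Describing both
  kinds of class by \<open>unit_class\<close>, which mentions neither ring, turns the action into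
  multiplication of representatives. Equal classes then give equal ideals only up to a unit a, which
  is absorbed into the invertible factor by a(JI) = (aJ)I. The units come from the arithmetic of R:
  a positive integer is a non-zero-divisor because R has a finite integer basis, hence it is
  invertible in the ambient ring; and every fractional ideal contains a positive integer, at which
  linear maps can be evaluated. That (I : I') is again a fractional ideal has two sources: one
  expression of 1 as a sum of products supplies finitely many generators, and a common denominator
  over the generators of I' shows that it spans.\<close>

lemma zero_in_ideal_mult: "0 \<in> ideal_mult I J"
  unfolding ideal_mult_def by (auto intro!: exI[of _ "0::nat"])

lemma ideal_mult_add_product:
  assumes "z \<in> ideal_mult I J" "a \<in> I" "b \<in> J"
  shows "z + a * b \<in> ideal_mult I J"
proof -
  obtain n :: nat and x y where z: "z = (\<Sum>i<n. x i * y i)" and xy: "\<forall>i<n. x i \<in> I \<and> y i \<in> J"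
    using assms(1) unfolding ideal_mult_def by blast
  \<comment> \<open>\<open>n\<close> is the first index outside the old sum, so the updates leave
    every old term alone.\<close>
  have "z + a * b = (\<Sum>i<Suc n. (x(n := a)) i * (y(n := b)) i)"
    unfolding z by (simp add: sum.lessThan_Suc)
  moreover have "\<forall>i<Suc n. (x(n := a)) i \<in> I \<and> (y(n := b)) i \<in> J"
    using xy assms(2,3) by (simp add: less_Suc_eq)
  ultimately show ?thesis
    unfolding ideal_mult_def by blast
qed

lemma product_in_ideal_mult: "a \<in> I \<Longrightarrow> b \<in> J \<Longrightarrow> a * b \<in> ideal_mult I J"
  using ideal_mult_add_product[OF zero_in_ideal_mult] by fastforce

text \<open>The induction over finite sums is done here once. With a set comprehension for
  \<open>M\<close> it becomes an induction principle: a property that holds at 0 and survives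
  addition need only be checked on single products.\<close>

lemma ideal_mult_subset:
  assumes "0 \<in> M" "\<And>x y. x \<in> M \<Longrightarrow> y \<in> M \<Longrightarrow> x + y \<in> M"
    and "\<And>x y. x \<in> I \<Longrightarrow> y \<in> J \<Longrightarrow> x * y \<in> M"
  shows "ideal_mult I J \<subseteq> M"
proof
  fix z assume "z \<in> ideal_mult I J"
  then obtain n :: nat and x y where z: "z = (\<Sum>i<n. x i * y i)" and "\<forall>i<n. x i \<in> I \<and> y i \<in> J"
    unfolding ideal_mult_def by blast
  then show "z \<in> M"
    unfolding z by (induction n) (auto intro: assms)
qed

lemma ideal_mult_add:
  assumes z: "z \<in> ideal_mult I J" and w: "w \<in> ideal_mult I J"
  shows "z + w \<in> ideal_mult I J"
proof -
  obtain n :: nat and x y where w: "w = (\<Sum>i<n. x i * y i)" and "\<forall>i<n. x i \<in> I \<and> y i \<in> J"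
    using w unfolding ideal_mult_def by blast
  then show ?thesis
    unfolding w
    by (induction n) (auto simp: z add.assoc[symmetric] intro: ideal_mult_add_product)
qed

lemma ideal_mult_commute: "ideal_mult I J = ideal_mult J I"
proof -
  have "ideal_mult A B \<subseteq> ideal_mult B A" for A B :: "'a set"
  proof (rule ideal_mult_subset)
    fix x y assume "x \<in> A" "y \<in> B"
    then show "x * y \<in> ideal_mult B A"
      using product_in_ideal_mult[of y B x A] by (simp add: mult.commute)
  qed (auto intro: zero_in_ideal_mult ideal_mult_add)
  then show ?thesis by blast
qed

text \<open>Freezing l in L and looking at all z with z * l in the target leaves only z = x * y to
  check. The reverse inclusion is the same one read through commutativity.\<close>

lemma ideal_mult_assoc: "ideal_mult (ideal_mult I J) L = ideal_mult I (ideal_mult J L)"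
proof -
  have le: "ideal_mult (ideal_mult I J) L \<subseteq> ideal_mult I (ideal_mult J L)" for I J L :: "'a set"
  proof (rule ideal_mult_subset)
    fix z l assume z: "z \<in> ideal_mult I J" and l: "l \<in> L"
    have "ideal_mult I J \<subseteq> {z. z * l \<in> ideal_mult I (ideal_mult J L)}"
    proof (rule ideal_mult_subset)
      fix x y assume "x \<in> I" "y \<in> J"
      then show "x * y \<in> {z. z * l \<in> ideal_mult I (ideal_mult J L)}"
        by (simp add: l product_in_ideal_mult mult.assoc)
    qed (auto simp: distrib_right intro: zero_in_ideal_mult ideal_mult_add)
    then show "z * l \<in> ideal_mult I (ideal_mult J L)"
      using z by blast
  qed (auto intro: zero_in_ideal_mult ideal_mult_add)
  have "ideal_mult I (ideal_mult J L) \<subseteq> ideal_mult (ideal_mult I J) L"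
    using le[of L J I] by (simp add: ideal_mult_commute)
  with le show ?thesis by blast
qed

lemma ideal_mult_mono: "I \<subseteq> I' \<Longrightarrow> J \<subseteq> J' \<Longrightarrow> ideal_mult I J \<subseteq> ideal_mult I' J'"
  by (rule ideal_mult_subset) (auto intro: zero_in_ideal_mult ideal_mult_add product_in_ideal_mult)

text \<open>For units this makes products of classes well defined and lets an isomorphism be
  absorbed into one factor.\<close>

lemma ideal_mult_scale: "ideal_mult ((*) a ` I) J = (*) a ` ideal_mult I J"
proof
  show "ideal_mult ((*) a ` I) J \<subseteq> (*) a ` ideal_mult I J"
  proof (rule ideal_mult_subset)
    show "0 \<in> (*) a ` ideal_mult I J"
      using zero_in_ideal_mult by force
    show "x * y \<in> (*) a ` ideal_mult I J" if "x \<in> (*) a ` I" "y \<in> J" for x y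
      using that by (auto simp: mult.assoc intro: product_in_ideal_mult)
    show "x + y \<in> (*) a ` ideal_mult I J"
      if "x \<in> (*) a ` ideal_mult I J" "y \<in> (*) a ` ideal_mult I J" for x y
      using that by (auto simp: distrib_left[symmetric] intro: ideal_mult_add)
  qed
  have "ideal_mult I J \<subseteq> {z. a * z \<in> ideal_mult ((*) a ` I) J}"
    by (rule ideal_mult_subset)
      (auto simp: distrib_left mult.assoc[symmetric]
        intro: zero_in_ideal_mult ideal_mult_add product_in_ideal_mult)
  then show "(*) a ` ideal_mult I J \<subseteq> ideal_mult ((*) a ` I) J"
    by blast
qed

lemma ideal_mult_scale_right: "ideal_mult I ((*) a ` J) = (*) a ` ideal_mult I J"
  by (metis ideal_mult_commute ideal_mult_scale)

lemma scale_scale: "(*) a ` (*) b ` I = (*) (a * b) ` (I :: 'a::comm_ring_1 set)"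
  by (simp add: image_image mult.assoc)

lemma unit_inverse:
  assumes "(a :: 'a::comm_ring_1) dvd 1"
  obtains b where "a * b = 1" "b dvd 1"
  using assms by (metis dvdE dvdI mult.commute)

lemma is_unit_mult: "(a :: 'a::comm_ring_1) dvd 1 \<Longrightarrow> b dvd 1 \<Longrightarrow> a * b dvd 1"
  using mult_dvd_mono[of a 1 b 1] by simp

section \<open>Submodules and finite generation\<close>

lemma subring_one: "is_subring T \<Longrightarrow> 1 \<in> T"
  and subring_mult: "is_subring T \<Longrightarrow> x \<in> T \<Longrightarrow> y \<in> T \<Longrightarrow> x * y \<in> T"
  and subring_zero: "is_subring T \<Longrightarrow> 0 \<in> T"
  unfolding is_subring_def by auto (metis cancel_comm_monoid_add_class.diff_cancel)

lemma subring_add: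
  assumes "is_subring T" "x \<in> T" "y \<in> T"
  shows "x + y \<in> T"
proof -
  have "x - (0 - y) \<in> T"
    using assms subring_zero[OF assms(1)] unfolding is_subring_def by blast
  then show ?thesis by simp
qed

lemma subring_of_nat: "is_subring T \<Longrightarrow> of_nat n \<in> T"
  by (induction n) (auto intro: subring_zero subring_one subring_add)

lemma subring_submodule: "is_subring T \<Longrightarrow> is_submodule T T"
  unfolding is_submodule_def by (auto intro: subring_zero subring_add subring_mult)

lemma submodule_zero: "is_submodule T I \<Longrightarrow> 0 \<in> I"
  and submodule_add: "is_submodule T I \<Longrightarrow> x \<in> I \<Longrightarrow> y \<in> I \<Longrightarrow> x + y \<in> I"
  and submodule_scale: "is_submodule T I \<Longrightarrow> r \<in> T \<Longrightarrow> x \<in> I \<Longrightarrow> r * x \<in> I"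
  unfolding is_submodule_def by auto

lemma submodule_sum:
  "is_submodule T I \<Longrightarrow> (\<And>g. g \<in> G \<Longrightarrow> f g \<in> I) \<Longrightarrow> sum f G \<in> I"
  by (induction G rule: infinite_finite_induct) (auto intro: submodule_zero submodule_add)

lemma submodule_of_nat_scale:
  assumes "is_submodule T I" "x \<in> I"
  shows "of_nat n * x \<in> I"
  using assms by (induction n) (auto simp: distrib_right intro: submodule_zero submodule_add)

lemma submodule_subring_mono: "is_submodule T I \<Longrightarrow> T' \<subseteq> T \<Longrightarrow> is_submodule T' I"
  unfolding is_submodule_def by blast

text \<open>Serves for colon ideals and as a test set: to show that multiplication by
  \<open>Y\<close> sends a finitely generated module into \<open>M\<close>, it is enough to look at
  generators.\<close>

lemma submodule_vimage:
  assumes "is_submodule T M"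
  shows "is_submodule T {x. \<forall>y\<in>Y. x * y \<in> M}"
  using assms unfolding is_submodule_def by (auto simp: distrib_right mult.assoc)

lemma submodule_ideal_mult:
  assumes "is_submodule T I"
  shows "is_submodule T (ideal_mult I J)"
  unfolding is_submodule_def
proof (intro conjI ballI)
  fix r x assume r: "r \<in> T" and x: "x \<in> ideal_mult I J"
  have "ideal_mult I J \<subseteq> {x. r * x \<in> ideal_mult I J}"
    by (rule ideal_mult_subset)
      (auto simp: distrib_left mult.assoc[symmetric] submodule_scale[OF assms r]
        intro: zero_in_ideal_mult ideal_mult_add product_in_ideal_mult)
  with x show "r * x \<in> ideal_mult I J" by blast
qed (auto intro: zero_in_ideal_mult ideal_mult_add)

lemma submodule_scale_image:
  assumes "is_submodule T I"
  shows "is_submodule T ((*) a ` I)"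
  unfolding is_submodule_def
proof (intro conjI ballI)
  show "0 \<in> (*) a ` I"
    using submodule_zero[OF assms] by force
  show "x + y \<in> (*) a ` I" if "x \<in> (*) a ` I" "y \<in> (*) a ` I" for x y
    using that by (auto simp: distrib_left[symmetric] intro: submodule_add[OF assms])
  show "r * x \<in> (*) a ` I" if "r \<in> T" "x \<in> (*) a ` I" for r x
    using that by (auto simp: mult.left_commute[of r] intro: submodule_scale[OF assms])
qed

lemma subring_ideal_mult:
  assumes "is_subring T" "is_submodule T I"
  shows "ideal_mult T I = I"
proof
  show "ideal_mult T I \<subseteq> I"
    using assms(2) by (intro ideal_mult_subset) (auto simp: is_submodule_def)
  show "I \<subseteq> ideal_mult T I"
    using product_in_ideal_mult[of 1 T _ I] subring_one[OF assms(1)] by auto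
qed

text \<open>The combinations of \<open>G\<close> form the least submodule containing
  \<open>G\<close>. This form hides coefficient families, so later proofs only compare
  submodules.\<close>

lemma finitely_generated_iff:
  assumes T: "is_subring T" and I: "is_submodule T I"
  shows "is_finitely_generated T I \<longleftrightarrow>
    (\<exists>G. finite G \<and> G \<subseteq> I \<and> (\<forall>M. is_submodule T M \<longrightarrow> G \<subseteq> M \<longrightarrow> I \<subseteq> M))"
proof
  assume "is_finitely_generated T I"
  then obtain G where G: "finite G" "G \<subseteq> I" "I = {\<Sum>g\<in>G. c g * g | c. \<forall>g\<in>G. c g \<in> T}"
    unfolding is_finitely_generated_def by blast
  have "I \<subseteq> M" if "is_submodule T M" "G \<subseteq> M" for M
    unfolding G(3) using that by (auto intro!: submodule_sum submodule_scale)
  with G(1,2) show "\<exists>G. finite G \<and> G \<subseteq> I \<and> (\<forall>M. is_submodule T M \<longrightarrow> G \<subseteq> M \<longrightarrow> I \<subseteq> M)"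
    by blast
next
  assume "\<exists>G. finite G \<and> G \<subseteq> I \<and> (\<forall>M. is_submodule T M \<longrightarrow> G \<subseteq> M \<longrightarrow> I \<subseteq> M)"
  then obtain G where G: "finite G" "G \<subseteq> I"
    and min: "\<And>M. is_submodule T M \<Longrightarrow> G \<subseteq> M \<Longrightarrow> I \<subseteq> M"
    by blast
  \<comment> \<open>\<open>M\<close> is the explicit span of \<open>G\<close>. Once it is a
    submodule containing \<open>G\<close>, minimality gives one inclusion and closure of
    \<open>I\<close> under combinations the other.\<close>
  define M where "M = {\<Sum>g\<in>G. c g * g | c. \<forall>g\<in>G. c g \<in> T}"
  have MI: "(\<Sum>g\<in>G. c g * g) \<in> M" if "\<And>g. g \<in> G \<Longrightarrow> c g \<in> T" for c
    using that unfolding M_def by blast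
  have "is_submodule T M"
    unfolding is_submodule_def
  proof (intro conjI ballI)
    show "0 \<in> M"
      using MI[of "\<lambda>_. 0"] subring_zero[OF T] by simp
    show "x + y \<in> M" if x: "x \<in> M" and y: "y \<in> M" for x y
    proof -
      obtain c where c: "x = (\<Sum>g\<in>G. c g * g)" "\<forall>g\<in>G. c g \<in> T"
        using x unfolding M_def by blast
      obtain d where d: "y = (\<Sum>g\<in>G. d g * g)" "\<forall>g\<in>G. d g \<in> T"
        using y unfolding M_def by blast
      show ?thesis
        using MI[of "\<lambda>g. c g + d g"] c d subring_add[OF T]
        by (simp add: distrib_right sum.distrib)
    qed
    show "r * x \<in> M" if r: "r \<in> T" and x: "x \<in> M" for r x
    proof -
      obtain c where c: "x = (\<Sum>g\<in>G. c g * g)" "\<forall>g\<in>G. c g \<in> T"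
        using x unfolding M_def by blast
      show ?thesis
        using MI[of "\<lambda>g. r * c g"] c r subring_mult[OF T]
        by (simp add: sum_distrib_left mult.assoc)
    qed
  qed
  moreover have "G \<subseteq> M"
  proof
    fix h assume h: "h \<in> G"
    have "(\<Sum>g\<in>G. (if g = h then 1 else 0) * g) = h"
      using h G(1) by (simp add: if_distrib[of "\<lambda>x. x * _"] cong: if_cong)
    then show "h \<in> M"
      using MI[of "\<lambda>g. if g = h then 1 else 0"] subring_zero[OF T] subring_one[OF T] by simp
  qed
  ultimately have "I \<subseteq> M" by (rule min)
  moreover have "M \<subseteq> I"
    unfolding M_def using G(2) I by (auto intro!: submodule_sum submodule_scale)
  ultimately show "is_finitely_generated T I"
    using G unfolding is_finitely_generated_def M_def by blast
qed

text \<open>The coefficient ring \<open>T'\<close> of the second factor may be larger than \<open>T\<close>; with \<open>I = T'\<close>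
  this is transitivity of finite generation.\<close>

lemma finitely_generated_ideal_mult:
  assumes T: "is_subring T" "is_subring T'" and I: "is_submodule T I" "is_submodule T' I"
    and J: "is_submodule T' J"
    and fg: "is_finitely_generated T I" "is_finitely_generated T' J"
  shows "is_finitely_generated T (ideal_mult I J)"
proof -
  obtain G where G: "finite G" "G \<subseteq> I"
    and G_min: "\<And>M. is_submodule T M \<Longrightarrow> G \<subseteq> M \<Longrightarrow> I \<subseteq> M"
    using fg(1) unfolding finitely_generated_iff[OF T(1) I(1)] by blast
  obtain H where H: "finite H" "H \<subseteq> J"
    and H_min: "\<And>M. is_submodule T' M \<Longrightarrow> H \<subseteq> M \<Longrightarrow> J \<subseteq> M"
    using fg(2) unfolding finitely_generated_iff[OF T(2) J] by blast
  define P where "P = (\<lambda>(g, h). g * h) ` (G \<times> H)"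
  have "ideal_mult I J \<subseteq> M" if M: "is_submodule T M" and P: "P \<subseteq> M" for M
  proof -
    \<comment> \<open>First extension, from \<open>G\<close> to all of \<open>I\<close>, with the
      second factor still confined to \<open>H\<close>.\<close>
    have "I \<subseteq> {x. \<forall>h\<in>H. x * h \<in> M}"
      using P by (intro G_min submodule_vimage M) (auto simp: P_def)
    then have IH: "h * x \<in> M" if "x \<in> I" "h \<in> H" for x h
      using that by (auto simp: mult.commute)
    \<comment> \<open>\<open>M\<close> is only a T-module, so a scalar r from \<open>T'\<close> is
      moved onto x, which stays in \<open>I\<close> because \<open>I\<close> is a T'-module as
      well.\<close>
    have "is_submodule T' {y. \<forall>x\<in>I. y * x \<in> M}"
      unfolding is_submodule_def
    proof (intro conjI ballI)
      fix r y assume r: "r \<in> T'" and y: "y \<in> {y. \<forall>x\<in>I. y * x \<in> M}"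
      have "y * (r * x) \<in> M" if "x \<in> I" for x
        using y submodule_scale[OF I(2) r that] by blast
      then show "r * y \<in> {y. \<forall>x\<in>I. y * x \<in> M}"
        by (simp add: ac_simps)
    qed (use submodule_zero[OF M] submodule_add[OF M] in \<open>auto simp: distrib_right\<close>)
    then have "J \<subseteq> {y. \<forall>x\<in>I. y * x \<in> M}"
      by (rule H_min) (use IH in blast)
    then show ?thesis
      using submodule_zero[OF M] submodule_add[OF M]
      by (subst ideal_mult_commute) (intro ideal_mult_subset; blast)
  qed
  moreover have "finite P" "P \<subseteq> ideal_mult I J"
    using G H by (auto simp: P_def intro!: product_in_ideal_mult)
  ultimately show ?thesis
    unfolding finitely_generated_iff[OF T(1) submodule_ideal_mult[OF I(1)]] by blast
qed

lemma finitely_generated_scale: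
  assumes T: "is_subring T" and I: "is_submodule T I" and fg: "is_finitely_generated T I"
  shows "is_finitely_generated T ((*) a ` I)"
proof -
  obtain G where G: "finite G" "G \<subseteq> I"
    and G_min: "\<And>M. is_submodule T M \<Longrightarrow> G \<subseteq> M \<Longrightarrow> I \<subseteq> M"
    using fg unfolding finitely_generated_iff[OF T I] by blast
  have "(*) a ` I \<subseteq> M" if "is_submodule T M" "(*) a ` G \<subseteq> M" for M
  proof -
    have "I \<subseteq> {x. \<forall>y\<in>{a}. x * y \<in> M}"
      using that by (intro G_min submodule_vimage) (auto simp: mult.commute)
    then show ?thesis by (auto simp: mult.commute)
  qed
  moreover have "finite ((*) a ` G)" "(*) a ` G \<subseteq> (*) a ` I"
    using G by auto
  ultimately show ?thesis
    unfolding finitely_generated_iff[OF T submodule_scale_image[OF I]] by blast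
qed

text \<open>The same generators serve: a T'-submodule containing them is in particular a
  T-submodule.\<close>

lemma finitely_generated_extend:
  assumes T: "is_subring T" "is_subring T'" "T \<subseteq> T'" and I: "is_submodule T' I"
    and fg: "is_finitely_generated T I"
  shows "is_finitely_generated T' I"
proof -
  have "is_submodule T M" if "is_submodule T' M" for M
    using that T(3) by (rule submodule_subring_mono)
  then show ?thesis
    using fg
    unfolding finitely_generated_iff[OF T(2) I]
      finitely_generated_iff[OF T(1) submodule_subring_mono[OF I T(3)]]
    by meson
qed

section \<open>Fractional ideals\<close>

lemma fractional_submodule: "fractional_ideal T I \<Longrightarrow> is_submodule T I"
  and fractional_spans: "fractional_ideal T I \<Longrightarrow> spans_over_rationals I"
  unfolding fractional_ideal_def by auto

lemma spans_obtains:
  assumes "spans_over_rationals I"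
  obtains n :: nat where "n > 0" "of_nat n * x \<in> I"
  using assms unfolding spans_over_rationals_def by blast

lemma fractional_ideal_mult:
  assumes T: "is_subring T" and I: "fractional_ideal T I" and J: "fractional_ideal T J"
  shows "fractional_ideal T (ideal_mult I J)"
proof -
  have "spans_over_rationals (ideal_mult I J)"
    unfolding spans_over_rationals_def
  proof
    fix x
    obtain n where n: "n > 0" "of_nat n * x \<in> I"
      using spans_obtains[OF fractional_spans[OF I]] .
    \<comment> \<open>Taking x = 1 puts the integer m itself into \<open>J\<close>, so (n * x) * m
      is a multiple of x in the product.\<close>
    obtain m where m: "m > 0" "of_nat m * 1 \<in> J"
      using spans_obtains[OF fractional_spans[OF J]] .
    have "of_nat (n * m) * x \<in> ideal_mult I J"
      using product_in_ideal_mult[OF n(2) m(2)] by (simp add: ac_simps)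
    then show "\<exists>y\<in>ideal_mult I J. \<exists>n::nat. n > 0 \<and> of_nat n * x = y"
      using n m by (metis nat_0_less_mult_iff)
  qed
  then show ?thesis
    using I J finitely_generated_ideal_mult[OF T T, of I J] submodule_ideal_mult[of T I J]
    unfolding fractional_ideal_def by blast
qed

lemma fractional_ideal_scale:
  assumes T: "is_subring T" and I: "fractional_ideal T I" and a: "a dvd 1"
  shows "fractional_ideal T ((*) a ` I)"
proof -
  obtain b where b: "a * b = 1"
    using unit_inverse[OF a] .
  have "spans_over_rationals ((*) a ` I)"
    unfolding spans_over_rationals_def
  proof
    fix x
    \<comment> \<open>The denominator is cleared for b * x, so that multiplying by a returns to
      x.\<close>
    obtain n where n: "n > 0" "of_nat n * (b * x) \<in> I"
      using spans_obtains[OF fractional_spans[OF I]] .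
    have "of_nat n * x = a * (of_nat n * (b * x))"
      using b by (metis mult.assoc mult.left_commute mult_1)
    then show "\<exists>y\<in>(*) a ` I. \<exists>n::nat. n > 0 \<and> of_nat n * x = y"
      using n by blast
  qed
  then show ?thesis
    using I finitely_generated_scale[OF T, of I a] submodule_scale_image[of T I a]
    unfolding fractional_ideal_def by blast
qed

lemma fractional_ideal_self:
  assumes T: "is_subring T" and span: "spans_over_rationals T"
  shows "fractional_ideal T T"
proof -
  have "T \<subseteq> M" if M: "is_submodule T M" "{1} \<subseteq> M" for M
    using submodule_scale[OF M(1), of _ 1] that by auto
  then have "is_finitely_generated T T"
    unfolding finitely_generated_iff[OF T subring_submodule[OF T]]
    using subring_one[OF T] by (intro exI[of _ "{1}"]) auto
  then show ?thesis
    using span subring_submodule[OF T] unfolding fractional_ideal_def by blast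
qed

lemma colon_submodule: "is_submodule T I \<Longrightarrow> is_submodule T (colon I J)"
  unfolding colon_def by (rule submodule_vimage)

lemma submodule_multiplicator_ring:
  assumes "is_submodule T I"
  shows "is_submodule (multiplicator_ring I) I"
  using assms unfolding is_submodule_def multiplicator_ring_def colon_def by blast

text \<open>For given x, each x * g with g a generator of \<open>J\<close> has a denominator
  relative to \<open>I\<close>; the product of these finitely many denominators brings x into the
  colon.\<close>

lemma spans_colon:
  assumes T: "is_subring T" and I: "fractional_ideal T I" and J: "fractional_ideal T J"
  shows "spans_over_rationals (colon I J)"
  unfolding spans_over_rationals_def
proof
  fix x
  note subI = fractional_submodule[OF I] and subJ = fractional_submodule[OF J]
  obtain G where G: "finite G"
    and G_min: "\<And>M. is_submodule T M \<Longrightarrow> G \<subseteq> M \<Longrightarrow> J \<subseteq> M"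
    using J unfolding fractional_ideal_def finitely_generated_iff[OF T subJ] by blast
  have "\<exists>n::nat. n > 0 \<and> (\<forall>g\<in>G. of_nat n * (x * g) \<in> I)"
    using G
  proof (induction G)
    case (insert g G)
    then obtain n :: nat where n: "n > 0" "\<forall>g\<in>G. of_nat n * (x * g) \<in> I"
      by blast
    obtain m where m: "m > 0" "of_nat m * (x * g) \<in> I"
      using spans_obtains[OF fractional_spans[OF I]] .
    have "of_nat n * (of_nat m * (x * g)) \<in> I"
      using submodule_of_nat_scale[OF subI m(2)] .
    moreover have "of_nat m * (of_nat n * (x * h)) \<in> I" if "h \<in> G" for h
      using submodule_of_nat_scale[OF subI] n(2) that by blast
    ultimately show ?case
      using n(1) m(1) by (intro exI[of _ "n * m"]) (auto simp: ac_simps)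
  qed (auto intro: exI[of _ 1])
  then obtain n :: nat where n: "n > 0" "\<forall>g\<in>G. of_nat n * (x * g) \<in> I"
    by blast
  have "J \<subseteq> {y. \<forall>z\<in>{of_nat n * x}. y * z \<in> I}"
    using n(2) by (intro G_min submodule_vimage subI) (auto simp: mult.commute mult.left_commute)
  then have "of_nat n * x \<in> colon I J"
    unfolding colon_def by (auto simp: ac_simps)
  with n(1) show "\<exists>y\<in>colon I J. \<exists>n::nat. n > 0 \<and> of_nat n * x = y"
    by blast
qed

section \<open>Weak equivalence\<close>

lemma weakly_equivalent_refl: "weakly_equivalent I I"
  using product_in_ideal_mult[of 1 "colon I I" 1 "colon I I"]
  unfolding weakly_equivalent_def colon_def by simp

lemma weakly_equivalent_sym: "weakly_equivalent I J \<Longrightarrow> weakly_equivalent J I"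
  unfolding weakly_equivalent_def by (simp add: ideal_mult_commute)

lemma colon_mult: "u \<in> colon I J \<Longrightarrow> v \<in> colon J L \<Longrightarrow> u * v \<in> colon I L"
  unfolding colon_def by (simp add: mult.assoc)

text \<open>Multiply the two expressions of 1: each term regroups as (u * v) * (s * t) = (u * s) *
  (t * v), with u * s in (I : L) and t * v in (L : I).\<close>

lemma weakly_equivalent_trans:
  assumes "weakly_equivalent I J" "weakly_equivalent J L"
  shows "weakly_equivalent I L"
proof -
  let ?M = "ideal_mult (colon I L) (colon L I)"
  have mem: "(u * v) * (s * t) \<in> ?M"
    if "u \<in> colon I J" "v \<in> colon J I" "s \<in> colon J L" "t \<in> colon L J" for u v s t
  proof -
    have "(u * s) * (t * v) \<in> ?M"
      by (intro product_in_ideal_mult colon_mult) (rule that)+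
    then show ?thesis
      by (simp add: ac_simps)
  qed
  have "ideal_mult (colon I J) (colon J I) \<subseteq> {z. z * (s * t) \<in> ?M}"
    if "s \<in> colon J L" "t \<in> colon L J" for s t
    using that mem
    by (intro ideal_mult_subset)
      (auto simp: distrib_right intro: zero_in_ideal_mult ideal_mult_add)
  \<comment> \<open>The first expression of 1 is spent here, by putting z = 1.\<close>
  then have "s * t \<in> ?M" if "s \<in> colon J L" "t \<in> colon L J" for s t
    using that assms(1) unfolding weakly_equivalent_def
    by (metis (lifting) mem_Collect_eq mult_1 subsetD)
  then have "ideal_mult (colon J L) (colon L J) \<subseteq> ?M"
    by (intro ideal_mult_subset zero_in_ideal_mult ideal_mult_add)
  then show ?thesis
    using assms(2) unfolding weakly_equivalent_def by blast
qed

text \<open>If x preserves A, then v * x * u maps B to A, to A, and back to B. Summing over an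
  expression of 1 by products u * v shows that x preserves B.\<close>

lemma weakly_equivalent_multiplicator_ring:
  assumes "weakly_equivalent I J" "is_submodule T I" "is_submodule T J"
  shows "multiplicator_ring I = multiplicator_ring J"
proof -
  have le: "multiplicator_ring A \<subseteq> multiplicator_ring B"
    if "weakly_equivalent A B" and B: "is_submodule T B" for A B
  proof
    fix x assume x: "x \<in> multiplicator_ring A"
    have "ideal_mult (colon A B) (colon B A) \<subseteq> {z. x * z \<in> multiplicator_ring B}"
    proof (rule ideal_mult_subset)
      fix u v assume u: "u \<in> colon A B" and v: "v \<in> colon B A"
      have "v * (x * u) \<in> colon B B"
        using x u v by (intro colon_mult) (auto simp: multiplicator_ring_def)
      then show "u * v \<in> {z. x * z \<in> multiplicator_ring B}"
        by (simp add: multiplicator_ring_def ac_simps)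
    qed (use submodule_zero[OF B] submodule_add[OF B]
        in \<open>auto simp: multiplicator_ring_def colon_def distrib_left distrib_right\<close>)
    then show "x \<in> multiplicator_ring B"
      using that(1) unfolding weakly_equivalent_def by auto
  qed
  show ?thesis
    using le assms weakly_equivalent_sym by blast
qed

lemma weak_class_eq_iff:
  assumes "fractional_ideal T I" "fractional_ideal T J"
  shows "weak_class T I = weak_class T J \<longleftrightarrow> weakly_equivalent I J"
  using assms weakly_equivalent_refl weakly_equivalent_sym weakly_equivalent_trans
  unfolding weak_class_def by blast

section \<open>Isomorphisms are multiplications by units\<close>

text \<open>Free of any coefficient ring, so the same set can serve as the isomorphism class over
  \<open>R\<close> and over \<open>S\<close>.\<close>

definition unit_class :: "'k::comm_ring_1 set \<Rightarrow> 'k set set" where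
  "unit_class I = {(*) a ` I | a. a dvd 1}"

lemma unit_classI: "a dvd 1 \<Longrightarrow> (*) a ` I \<in> unit_class I"
  unfolding unit_class_def by blast

lemma unit_classE:
  assumes "J \<in> unit_class I"
  obtains a where "a dvd 1" "J = (*) a ` I"
  using assms unfolding unit_class_def by blast

lemma unit_class_self: "I \<in> unit_class I"
  using unit_classI[of 1 I] by simp

lemma unit_class_subset:
  assumes "J \<in> unit_class I"
  shows "unit_class J \<subseteq> unit_class I"
proof
  fix L assume "L \<in> unit_class J"
  then obtain a b where "a dvd 1" "b dvd 1" "L = (*) (a * b) ` I"
    using assms by (auto elim!: unit_classE simp: scale_scale)
  then show "L \<in> unit_class I"
    using unit_classI[OF is_unit_mult, of a b I] by simp
qed

lemma unit_class_sym:
  assumes "J \<in> unit_class I"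
  shows "I \<in> unit_class J"
proof -
  obtain a where a: "a dvd 1" "J = (*) a ` I"
    using unit_classE[OF assms] .
  obtain b where b: "a * b = 1" "b dvd 1"
    using unit_inverse[OF a(1)] .
  have "I = (*) b ` J"
    using b(1) by (simp add: a(2) scale_scale mult.commute[of b a])
  then show ?thesis
    using b(2) unit_classI by blast
qed

lemma unit_class_eq_iff: "unit_class I = unit_class J \<longleftrightarrow> J \<in> unit_class I"
  using unit_class_self unit_class_subset unit_class_sym by blast

lemma int_scale_module: "module int_scale"
  by unfold_locales (simp_all add: int_scale_def algebra_simps)

lemma order_subring: "is_order R \<Longrightarrow> is_subring R"
  unfolding is_order_def by blast

lemma non_zero_divisor_unit: "is_order R \<Longrightarrow> non_zero_divisor R s \<Longrightarrow> s dvd 1"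
  unfolding is_order_def is_total_quotient_ring_of_def by blast

lemma order_denominator:
  assumes "is_order R"
  obtains s where "s * x \<in> R" "non_zero_divisor R s"
proof -
  have "\<exists>r\<in>R. \<exists>s. non_zero_divisor R s \<and> s * x = r"
    using assms unfolding is_order_def is_total_quotient_ring_of_def by simp
  then show thesis using that by blast
qed

text \<open>Multiplication by n multiplies each coordinate in a finite integer basis of
  \<open>R\<close> by n, hence is injective on \<open>R\<close>; the total quotient ring inverts
  such elements.\<close>

lemma of_nat_unit:
  fixes R :: "'k::comm_ring_1 set" and n :: nat
  assumes R: "is_order R" and n: "n > 0"
  shows "(of_nat n :: 'k) dvd 1"
proof (rule non_zero_divisor_unit[OF R])
  interpret module "int_scale :: int \<Rightarrow> 'k \<Rightarrow> 'k"
    by (rule int_scale_module)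
  obtain B :: "'k set" where B: "finite B" "independent B" "span B = R"
    using R unfolding is_order_def is_fg_free_int_module_def by blast
  have "y = 0" if y: "y \<in> R" and ny: "of_nat n * y = 0" for y
  proof -
    obtain u where u: "y = (\<Sum>b\<in>B. int_scale (u b) b)"
      using y B(3) span_finite[OF B(1)] by auto
    have "(\<Sum>b\<in>B. int_scale (int n * u b) b) = 0"
      using ny by (simp add: u int_scale_def sum_distrib_left mult.assoc)
    then have "int n * u b = 0" if "b \<in> B" for b
      using independentD[OF B(2,1), of "\<lambda>b. int n * u b"] that by simp
    then show "y = 0"
      using n by (simp add: u int_scale_def)
  qed
  then show "non_zero_divisor R (of_nat n)"
    using subring_of_nat[OF order_subring[OF R]] unfolding non_zero_divisor_def by blast
qed

text \<open>If \<open>n\<close> is a positive integer in \<open>I\<close>, a linear \<open>f\<close> on \<open>I\<close> is multiplication by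
  \<open>f n / n\<close>: write \<open>x \<in> I\<close> as a fraction \<open>r / s\<close> and evaluate \<open>f\<close> at \<open>r n = s n x\<close>.\<close>

lemma linear_map_is_scaling:
  fixes R :: "'k::comm_ring_1 set"
  assumes R: "is_order R" and I: "fractional_ideal R I"
    and lin: "\<And>r x. r \<in> R \<Longrightarrow> x \<in> I \<Longrightarrow> f (r * x) = r * f x"
  obtains a where "\<And>x. x \<in> I \<Longrightarrow> f x = a * x"
proof -
  note sub = order_subring[OF R]
  obtain n where n: "n > 0" "of_nat n * 1 \<in> I"
    using spans_obtains[OF fractional_spans[OF I]] .
  obtain m :: 'k where m: "of_nat n * m = 1"
    using unit_inverse[OF of_nat_unit[OF R n(1)]] by blast
  have "f x = m * f (of_nat n) * x" if x: "x \<in> I" for x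
  proof -
    obtain s where s: "s * x \<in> R" "non_zero_divisor R s"
      using order_denominator[OF R] by blast
    have "s * of_nat n \<in> R"
      using s(2) subring_mult[OF sub _ subring_of_nat[OF sub]]
      unfolding non_zero_divisor_def by blast
    then have "s * of_nat n * f x = f (s * of_nat n * x)"
      using lin x by metis
    also have "\<dots> = f (s * x * of_nat n)"
      by (simp add: mult.commute mult.left_commute)
    also have "\<dots> = s * x * f (of_nat n)"
      using lin[OF s(1), of "of_nat n"] n(2) by simp
    finally have E: "s * of_nat n * f x = s * x * f (of_nat n)" .
    obtain t where t: "s * t = 1"
      using unit_inverse[OF non_zero_divisor_unit[OF R s(2)]] by blast
    \<comment> \<open>The factors s and n are cancelled through their inverses t and m, since the
      ambient ring may have zero divisors.\<close>
    have "(s * t) * (of_nat n * m) * f x = t * m * (s * of_nat n * f x)"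
      by (simp add: mult.commute mult.left_commute)
    also have "\<dots> = (s * t) * (m * f (of_nat n) * x)"
      unfolding E by (simp add: mult.commute mult.left_commute)
    finally have "(s * t) * (of_nat n * m) * f x = (s * t) * (m * f (of_nat n) * x)" .
    then show ?thesis
      by (simp add: t m)
  qed
  then show thesis
    using that[of "m * f (of_nat n)"] by blast
qed

lemma scaling_ideal_iso:
  assumes "a dvd 1"
  shows "ideal_iso T I ((*) a ` I)"
proof -
  obtain b where b: "a * b = 1"
    using unit_inverse[OF assms] by blast
  have "inj_on ((*) a) I"
    by (rule inj_on_inverseI[of _ "(*) b"]) (simp add: b mult.assoc[symmetric] mult.commute[of b a])
  then show ?thesis
    unfolding ideal_iso_def bij_betw_def
    by (intro exI[of _ "(*) a"]) (simp add: distrib_left mult.left_commute)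
qed

text \<open>The right-hand side does not mention \<open>T\<close>: a T-linear map is already
  R-linear, and R-linearity forces a scaling, which is linear over everything.\<close>

lemma ideal_iso_iff:
  assumes R: "is_order R" and I: "fractional_ideal R I" and J: "fractional_ideal R J"
    and RT: "R \<subseteq> T"
  shows "ideal_iso T I J \<longleftrightarrow> J \<in> unit_class I"
proof
  assume "ideal_iso T I J"
  then obtain f where f: "f ` I = J" "\<And>r x. r \<in> R \<Longrightarrow> x \<in> I \<Longrightarrow> f (r * x) = r * f x"
    using RT unfolding ideal_iso_def bij_betw_def by blast
  obtain a where a: "\<And>x. x \<in> I \<Longrightarrow> f x = a * x"
    using linear_map_is_scaling[OF R I f(2)] by blast
  then have J_eq: "J = (*) a ` I"
    using f(1) by auto
  \<comment> \<open>A positive integer in J = aI is a multiple of a; being a unit, it makes a a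
    unit.\<close>
  obtain n where n: "n > 0" "of_nat n * 1 \<in> J"
    using spans_obtains[OF fractional_spans[OF J]] .
  then have "a dvd of_nat n"
    unfolding J_eq by auto
  then have "a dvd 1"
    using of_nat_unit[OF R n(1)] dvd_trans by blast
  then show "J \<in> unit_class I"
    unfolding J_eq by (rule unit_classI)
next
  assume "J \<in> unit_class I"
  then show "ideal_iso T I J"
    by (auto elim!: unit_classE intro: scaling_ideal_iso)
qed

section \<open>The Picard group acting on ideals with a given multiplicator ring\<close>

locale order_extension =
  fixes R S :: "'k::comm_ring_1 set"
  assumes order: "is_order R" and over_order: "over_order R S"
begin

section \<open>Comparing ideals and their classes over \<open>R\<close> and over
  \<open>S\<close>\<close>

lemma R_subring: "is_subring R"
  using order by (rule order_subring)

lemma S_subring: "is_subring S"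
  using over_order unfolding over_order_def by blast

lemma S_fractional_R: "fractional_ideal R S"
  using over_order unfolding over_order_def by blast

lemma R_subset_S: "R \<subseteq> S"
  using submodule_scale[OF fractional_submodule[OF S_fractional_R] _ subring_one[OF S_subring]]
  by auto

lemma S_fractional_S: "fractional_ideal S S"
  using fractional_ideal_self[OF S_subring fractional_spans[OF S_fractional_R]] .

text \<open>Transitivity of finite generation, applied to the product of \<open>S\<close> and
  \<open>I\<close>, which is \<open>I\<close> again: \<open>S\<close> is finitely generated over
  \<open>R\<close>. Conversely, generators over \<open>R\<close> also generate over
  \<open>S\<close>.\<close>

lemma fractional_S_iff: "fractional_ideal S I \<longleftrightarrow> fractional_ideal R I \<and> is_submodule S I"
proof
  assume I: "fractional_ideal S I"
  note sub = fractional_submodule[OF I]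
  have "is_finitely_generated R (ideal_mult S I)"
    using finitely_generated_ideal_mult[OF R_subring S_subring
        fractional_submodule[OF S_fractional_R] subring_submodule[OF S_subring] sub]
      S_fractional_R I
    unfolding fractional_ideal_def by blast
  then show "fractional_ideal R I \<and> is_submodule S I"
    using I submodule_subring_mono[OF sub R_subset_S] subring_ideal_mult[OF S_subring sub]
    unfolding fractional_ideal_def by simp
next
  assume "fractional_ideal R I \<and> is_submodule S I"
  then show "fractional_ideal S I"
    using finitely_generated_extend[OF R_subring S_subring R_subset_S]
    unfolding fractional_ideal_def by blast
qed

lemma fractional_S_imp_R: "fractional_ideal S I \<Longrightarrow> fractional_ideal R I"
  using fractional_S_iff by blast

text \<open>One argument for T = R and T = S. Scaling by a unit keeps an ideal fractional, so the
  fractionality condition in \<open>iso_class\<close> removes nothing.\<close>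

lemma iso_class_eq:
  assumes T: "is_subring T" "R \<subseteq> T"
    and T_imp_R: "\<And>J. fractional_ideal T J \<Longrightarrow> fractional_ideal R J"
    and I: "fractional_ideal T I"
  shows "iso_class T I = unit_class I"
proof -
  have "fractional_ideal T J" if "J \<in> unit_class I" for J
    using unit_classE[OF that] fractional_ideal_scale[OF T(1) I] by metis
  then show ?thesis
    using ideal_iso_iff[OF order T_imp_R[OF I] T_imp_R T(2)] unfolding iso_class_def by blast
qed

lemma iso_class_R: "fractional_ideal R I \<Longrightarrow> iso_class R I = unit_class I"
  by (rule iso_class_eq[OF R_subring]) auto

lemma iso_class_S: "fractional_ideal S I \<Longrightarrow> iso_class S I = unit_class I"
  by (rule iso_class_eq[OF S_subring R_subset_S fractional_S_imp_R])

text \<open>Changing representatives by units a and b scales the product by a * b, so the union in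
  \<open>class_mult\<close> is a nonempty union of one and the same class. The case T = S computes
  in \<open>Pic S\<close>, the case T = R computes the action.\<close>

lemma class_mult_eq:
  assumes T: "is_subring T" and iso: "\<And>I. fractional_ideal T I \<Longrightarrow> iso_class T I = unit_class I"
    and I: "fractional_ideal T I" and J: "fractional_ideal T J"
  shows "class_mult T (unit_class I) (unit_class J) = unit_class (ideal_mult I J)"
proof -
  have "iso_class T (ideal_mult I' J') = unit_class (ideal_mult I J)"
    if I': "I' \<in> unit_class I" and J': "J' \<in> unit_class J" for I' J'
  proof -
    obtain a where a: "a dvd 1" "I' = (*) a ` I"
      using unit_classE[OF I'] .
    obtain b where b: "b dvd 1" "J' = (*) b ` J"
      using unit_classE[OF J'] .
    have eq: "ideal_mult I' J' = (*) (a * b) ` ideal_mult I J"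
      unfolding a(2) b(2)
      by (simp add: ideal_mult_scale ideal_mult_scale_right scale_scale mult.commute[of b a])
    have ab: "a * b dvd 1"
      using a(1) b(1) by (rule is_unit_mult)
    have "fractional_ideal T (ideal_mult I' J')"
      unfolding eq by (intro fractional_ideal_scale fractional_ideal_mult T I J ab)
    moreover have "unit_class (ideal_mult I J) = unit_class (ideal_mult I' J')"
      unfolding unit_class_eq_iff eq using ab by (rule unit_classI)
    ultimately show ?thesis
      using iso by simp
  qed
  then show ?thesis
    using unit_class_self[of I] unit_class_self[of J] unfolding class_mult_def by blast
qed

lemmas class_mult_R = class_mult_eq[OF R_subring iso_class_R]
  and class_mult_S = class_mult_eq[OF S_subring iso_class_S]

text \<open>Proper in the sense used for quadratic orders: the multiplicator ring is exactly
  \<open>S\<close> and no larger.\<close>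

definition proper_ideal :: "'k set \<Rightarrow> bool" where
  "proper_ideal I \<longleftrightarrow> fractional_ideal R I \<and> multiplicator_ring I = S"

lemma proper_fractional_R: "proper_ideal I \<Longrightarrow> fractional_ideal R I"
  unfolding proper_ideal_def by blast

lemma proper_fractional_S:
  assumes "proper_ideal I"
  shows "fractional_ideal S I"
  using assms submodule_multiplicator_ring[OF fractional_submodule, of R I]
  unfolding fractional_S_iff proper_ideal_def by blast

lemma proper_submodule: "proper_ideal I \<Longrightarrow> is_submodule S I"
  using proper_fractional_S fractional_submodule by blast

section \<open>Invertible S-ideals and cancellation\<close>

lemma invertible_fractional: "invertible_ideal S J \<Longrightarrow> fractional_ideal S J"
  unfolding invertible_ideal_def by blast

lemma invertible_submodule: "invertible_ideal S J \<Longrightarrow> is_submodule S J"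
  using invertible_fractional fractional_submodule by blast

lemma invertibleE:
  assumes "invertible_ideal S J"
  obtains J' where "invertible_ideal S J'" "ideal_mult J J' = S" "ideal_mult J' J = S"
  using assms unfolding invertible_ideal_def by (metis ideal_mult_commute)

lemma invertible_self: "invertible_ideal S S"
  unfolding invertible_ideal_def
  using S_fractional_S subring_ideal_mult[OF S_subring subring_submodule[OF S_subring]] by blast

lemma cancel_inverse:
  assumes "ideal_mult J' J = S" "is_submodule S I"
  shows "ideal_mult J' (ideal_mult J I) = I"
  using assms subring_ideal_mult[OF S_subring] by (simp add: ideal_mult_assoc[symmetric])

lemma invertible_mult:
  assumes I: "invertible_ideal S I" and J: "invertible_ideal S J"
  shows "invertible_ideal S (ideal_mult I J)"
proof -
  obtain I' where I': "invertible_ideal S I'" "ideal_mult I I' = S" "ideal_mult I' I = S"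
    using invertibleE[OF I] .
  obtain J' where J': "invertible_ideal S J'" "ideal_mult J J' = S" "ideal_mult J' J = S"
    using invertibleE[OF J] .
  have "ideal_mult (ideal_mult I J) (ideal_mult J' I') = S"
    by (simp add: ideal_mult_assoc cancel_inverse[OF J'(2) invertible_submodule[OF I'(1)]] I'(2))
  then show ?thesis
    using fractional_ideal_mult[OF S_subring] I I'(1) J J'(1)
    unfolding invertible_ideal_def by blast
qed

lemma invertible_scale:
  assumes J: "invertible_ideal S J" and a: "a dvd 1"
  shows "invertible_ideal S ((*) a ` J)"
proof -
  obtain J' where J': "invertible_ideal S J'" "ideal_mult J J' = S"
    using invertibleE[OF J] .
  obtain b where b: "a * b = 1" "b dvd 1"
    using unit_inverse[OF a] .
  have "ideal_mult ((*) a ` J) ((*) b ` J') = S"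
    by (simp add: ideal_mult_scale ideal_mult_scale_right scale_scale J'(2) b(1) mult.commute[of b a])
  then show ?thesis
    using fractional_ideal_scale[OF S_subring] J J'(1) a b(2)
    unfolding invertible_ideal_def by blast
qed

text \<open>An x that preserves JI also preserves J'(JI) = I, where J' is the inverse of J, and so
  lies in \<open>S\<close>.\<close>

lemma proper_mult:
  assumes J: "invertible_ideal S J" and I: "proper_ideal I"
  shows "proper_ideal (ideal_mult J I)"
proof -
  note subI = proper_submodule[OF I]
  obtain J' where J': "invertible_ideal S J'" "ideal_mult J J' = S" "ideal_mult J' J = S"
    using invertibleE[OF J] .
  have cancel: "ideal_mult J' (ideal_mult J I) = I"
    using J'(3) subI by (rule cancel_inverse)
  have JI: "fractional_ideal S (ideal_mult J I)"
    by (rule fractional_ideal_mult[OF S_subring invertible_fractional[OF J] proper_fractional_S[OF I]])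
  have "multiplicator_ring (ideal_mult J I) \<subseteq> S"
  proof
    fix x assume x: "x \<in> multiplicator_ring (ideal_mult J I)"
    have "ideal_mult J' (ideal_mult J I) \<subseteq> {y. x * y \<in> ideal_mult J' (ideal_mult J I)}"
    proof (rule ideal_mult_subset)
      fix j z assume j: "j \<in> J'" and z: "z \<in> ideal_mult J I"
      have "x * z \<in> ideal_mult J I"
        using x z by (simp add: multiplicator_ring_def colon_def)
      with j have "j * (x * z) \<in> ideal_mult J' (ideal_mult J I)"
        by (rule product_in_ideal_mult)
      then show "j * z \<in> {y. x * y \<in> ideal_mult J' (ideal_mult J I)}"
        by (simp add: mult.left_commute)
    qed (simp_all add: distrib_left zero_in_ideal_mult ideal_mult_add)
    then have "x \<in> multiplicator_ring I"
      by (auto simp: cancel multiplicator_ring_def colon_def)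
    then show "x \<in> S"
      using I unfolding proper_ideal_def by blast
  qed
  moreover have "S \<subseteq> multiplicator_ring (ideal_mult J I)"
    by (auto simp: multiplicator_ring_def colon_def
        intro: submodule_scale[OF fractional_submodule[OF JI]])
  ultimately show ?thesis
    using fractional_S_imp_R[OF JI] unfolding proper_ideal_def by blast
qed

lemma cancel_proper_subset:
  assumes J: "invertible_ideal S J" and L: "invertible_ideal S L" and I: "proper_ideal I"
    and le: "ideal_mult J I \<subseteq> ideal_mult L I"
  shows "J \<subseteq> L"
proof -
  obtain L' where L': "invertible_ideal S L'" "ideal_mult L L' = S" "ideal_mult L' L = S"
    using invertibleE[OF L] .
  have "ideal_mult (ideal_mult L' J) I \<subseteq> ideal_mult L' (ideal_mult L I)"
    unfolding ideal_mult_assoc by (rule ideal_mult_mono[OF subset_refl le])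
  also have "\<dots> = I"
    using cancel_inverse[OF L'(3) proper_submodule[OF I]] .
  finally have "ideal_mult L' J \<subseteq> multiplicator_ring I"
    unfolding multiplicator_ring_def colon_def by (auto intro: product_in_ideal_mult)
  then have "ideal_mult L (ideal_mult L' J) \<subseteq> ideal_mult L S"
    using I unfolding proper_ideal_def by (intro ideal_mult_mono) auto
  then show ?thesis
    using cancel_inverse[OF L'(2) invertible_submodule[OF J]]
      subring_ideal_mult[OF S_subring invertible_submodule[OF L]]
    by (simp add: ideal_mult_commute[of L S])
qed

lemma cancel_proper:
  assumes "invertible_ideal S J" "invertible_ideal S L" "proper_ideal I"
    and "ideal_mult J I = ideal_mult L I"
  shows "J = L"
  using assms cancel_proper_subset by blast

text \<open>The unit relating JI and LI is moved into the first factor, (aJ)I = LI, after which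
  exact cancellation applies to the invertible ideals aJ and L.\<close>

lemma unit_class_cancel:
  assumes J: "invertible_ideal S J" and L: "invertible_ideal S L" and I: "proper_ideal I"
    and eq: "unit_class (ideal_mult J I) = unit_class (ideal_mult L I)"
  shows "unit_class J = unit_class L"
proof -
  obtain a where a: "a dvd 1" "ideal_mult L I = (*) a ` ideal_mult J I"
    using unit_classE eq unfolding unit_class_eq_iff by blast
  have "L = (*) a ` J"
    using cancel_proper[OF L invertible_scale[OF J a(1)] I] a(2) by (simp add: ideal_mult_scale)
  then show ?thesis
    using a(1) unit_classI unit_class_eq_iff by blast
qed

section \<open>Weak equivalence as multiplication by an invertible ideal\<close>

lemma weakly_equivalent_mult:
  assumes J: "invertible_ideal S J" and I: "proper_ideal I"
  shows "weakly_equivalent (ideal_mult J I) I"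
proof -
  obtain J' where J': "ideal_mult J J' = S" "ideal_mult J' J = S"
    using invertibleE[OF J] .
  \<comment> \<open>\<open>J\<close> and its inverse lie in the two colons, so S = JJ', and with it
    1, lies in their product.\<close>
  have "J \<subseteq> colon (ideal_mult J I) I"
    unfolding colon_def by (auto intro: product_in_ideal_mult)
  moreover have "J' \<subseteq> colon I (ideal_mult J I)"
    unfolding colon_def
    using cancel_inverse[OF J'(2) proper_submodule[OF I]] product_in_ideal_mult by blast
  ultimately have "S \<subseteq> ideal_mult (colon (ideal_mult J I) I) (colon I (ideal_mult J I))"
    using ideal_mult_mono J'(1) by metis
  then show ?thesis
    using subring_one[OF S_subring] unfolding weakly_equivalent_def by blast
qed

text \<open>If \<open>1 = \<Sum> x i * y i\<close> with \<open>x i \<in> (I : I')\<close> and \<open>y i \<in> (I' : I)\<close>, then the \<open>x i\<close>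
  generate \<open>(I : I')\<close>, because \<open>z = \<Sum> (z * y i) * x i\<close> and \<open>z * y i \<in> (I : I) = S\<close>.\<close>

lemma colon_finitely_generated:
  assumes weak: "weakly_equivalent I I'" and I: "proper_ideal I"
  shows "is_finitely_generated S (colon I I')"
proof -
  note sub = colon_submodule[OF proper_submodule[OF I], of I']
  obtain n :: nat and x y where one: "1 = (\<Sum>i<n. x i * y i)"
    and xy: "\<forall>i<n. x i \<in> colon I I' \<and> y i \<in> colon I' I"
    using weak unfolding weakly_equivalent_def ideal_mult_def by blast
  have "colon I I' \<subseteq> M" if M: "is_submodule S M" "x ` {..<n} \<subseteq> M" for M
  proof
    fix z assume z: "z \<in> colon I I'"
    have "(z * y i) * x i \<in> M" if "i < n" for i
    proof (rule submodule_scale[OF M(1)])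
      show "z * y i \<in> S"
        using colon_mult[OF z, of "y i" I] xy that I
        unfolding proper_ideal_def multiplicator_ring_def by blast
    qed (use M(2) that in blast)
    then have "(\<Sum>i<n. (z * y i) * x i) \<in> M"
      by (intro submodule_sum[OF M(1)]) simp
    moreover have "z = (\<Sum>i<n. (z * y i) * x i)"
      using arg_cong[OF one, of "(*) z"] by (simp add: sum_distrib_left ac_simps)
    ultimately show "z \<in> M" by simp
  qed
  moreover have "x ` {..<n} \<subseteq> colon I I'"
    using xy by blast
  ultimately show ?thesis
    unfolding finitely_generated_iff[OF S_subring sub] by blast
qed

lemma weakly_equivalent_imp_mult:
  assumes weak: "weakly_equivalent I' I" and I: "proper_ideal I" and I': "proper_ideal I'"
  obtains J where "invertible_ideal S J" "I' = ideal_mult J I"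
proof -
  have colon_fractional: "fractional_ideal S (colon A B)"
    if "weakly_equivalent A B" "proper_ideal A" "proper_ideal B" for A B
    using that colon_finitely_generated colon_submodule[OF proper_submodule]
      spans_colon[OF S_subring] proper_fractional_S
    unfolding fractional_ideal_def[of S "colon A B"] by blast
  define J L where "J = colon I' I" and "L = colon I I'"
  have J: "fractional_ideal S J" and L: "fractional_ideal S L"
    unfolding J_def L_def using colon_fractional weak weakly_equivalent_sym I I' by blast+
  have one: "1 \<in> ideal_mult J L"
    using weak unfolding weakly_equivalent_def J_def L_def .
  \<comment> \<open>Such a product maps I' to I and back, hence belongs to (I' : I') = S.\<close>
  have "u * v \<in> S" if "u \<in> J" "v \<in> L" for u v
    using colon_mult that I' unfolding J_def L_def proper_ideal_def multiplicator_ring_def by blast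
  then have "ideal_mult J L \<subseteq> S"
    by (intro ideal_mult_subset subring_zero[OF S_subring] subring_add[OF S_subring])
  moreover have "S \<subseteq> ideal_mult J L"
    using submodule_scale[OF submodule_ideal_mult[OF fractional_submodule[OF J]] _ one] by auto
  ultimately have JL: "ideal_mult J L = S" ..
  have JI: "ideal_mult J I \<subseteq> I'"
    using submodule_zero[OF proper_submodule[OF I']] submodule_add[OF proper_submodule[OF I']]
    by (intro ideal_mult_subset) (auto simp: J_def colon_def)
  have LI: "ideal_mult L I' \<subseteq> I"
    using submodule_zero[OF proper_submodule[OF I]] submodule_add[OF proper_submodule[OF I]]
    by (intro ideal_mult_subset) (auto simp: L_def colon_def)
  \<comment> \<open>The substantial inclusion: inserting S = JL in front of I' lets L carry I' into
    I.\<close>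
  have "I' = ideal_mult J (ideal_mult L I')"
    using cancel_inverse[OF JL proper_submodule[OF I']] by simp
  also have "\<dots> \<subseteq> ideal_mult J I"
    using LI by (intro ideal_mult_mono) auto
  finally have "I' = ideal_mult J I"
    using JI by blast
  moreover have "invertible_ideal S J"
    using J L JL unfolding invertible_ideal_def by blast
  ultimately show thesis using that by blast
qed

lemma weakly_equivalent_proper:
  assumes "weakly_equivalent I I'" "proper_ideal I" "fractional_ideal R I'"
  shows "proper_ideal I'"
  using weakly_equivalent_multiplicator_ring[OF assms(1), of R] assms
    fractional_submodule[of R I] fractional_submodule[of R I']
  unfolding proper_ideal_def by auto

lemma weak_class_eq:
  assumes I: "proper_ideal I"
  shows "weak_class R I = {ideal_mult J I | J. invertible_ideal S J}"
proof
  show "weak_class R I \<subseteq> {ideal_mult J I | J. invertible_ideal S J}"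
  proof
    fix I' assume "I' \<in> weak_class R I"
    then have weak: "weakly_equivalent I I'" and "fractional_ideal R I'"
      unfolding weak_class_def by auto
    then have I': "proper_ideal I'"
      using I weakly_equivalent_proper by blast
    obtain J where "invertible_ideal S J" "I' = ideal_mult J I"
      using weakly_equivalent_imp_mult[OF weakly_equivalent_sym[OF weak] I I'] .
    then show "I' \<in> {ideal_mult J I | J. invertible_ideal S J}"
      by blast
  qed
  show "{ideal_mult J I | J. invertible_ideal S J} \<subseteq> weak_class R I"
    using weakly_equivalent_sym[OF weakly_equivalent_mult[OF _ I]]
      proper_fractional_R[OF proper_mult[OF _ I]]
    unfolding weak_class_def by blast
qed

section \<open>The Picard group and its free action\<close>

lemma Pic_carrier: "carrier (Pic S) = unit_class ` {J. invertible_ideal S J}"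
  using iso_class_S[OF invertible_fractional] unfolding Pic_def by (auto simp: image_def)

lemma Pic_one: "\<one>\<^bsub>Pic S\<^esub> = unit_class S"
  using iso_class_S[OF S_fractional_S] unfolding Pic_def by simp

lemma Pic_mult:
  assumes "invertible_ideal S I" "invertible_ideal S J"
  shows "unit_class I \<otimes>\<^bsub>Pic S\<^esub> unit_class J = unit_class (ideal_mult I J)"
  using class_mult_S[OF _ invertible_fractional invertible_fractional] assms iso_class_S
  unfolding Pic_def by simp

lemma ICM_at_eq: "ICM_at R S = unit_class ` {I. proper_ideal I}"
  using iso_class_R unfolding ICM_at_def proper_ideal_def by (auto simp: image_def)

lemma W_at_eq: "W_at R S = weak_class R ` {I. proper_ideal I}"
  unfolding W_at_def proper_ideal_def by blast

lemma Pic_group: "group (Pic S)"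
proof (rule groupI)
  fix X Y Z assume "X \<in> carrier (Pic S)" "Y \<in> carrier (Pic S)" "Z \<in> carrier (Pic S)"
  then show "X \<otimes>\<^bsub>Pic S\<^esub> Y \<otimes>\<^bsub>Pic S\<^esub> Z = X \<otimes>\<^bsub>Pic S\<^esub> (Y \<otimes>\<^bsub>Pic S\<^esub> Z)"
    by (auto simp: Pic_carrier Pic_mult invertible_mult ideal_mult_assoc)
next
  fix X assume "X \<in> carrier (Pic S)"
  then obtain J where J: "invertible_ideal S J" "X = unit_class J"
    unfolding Pic_carrier by blast
  obtain J' where J': "invertible_ideal S J'" "ideal_mult J' J = S"
    using invertibleE[OF J(1)] .
  show "\<exists>Y\<in>carrier (Pic S). Y \<otimes>\<^bsub>Pic S\<^esub> X = \<one>\<^bsub>Pic S\<^esub>"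
    using J J' by (intro bexI[of _ "unit_class J'"]) (auto simp: Pic_mult Pic_one Pic_carrier)
  show "\<one>\<^bsub>Pic S\<^esub> \<otimes>\<^bsub>Pic S\<^esub> X = X"
    using subring_ideal_mult[OF S_subring invertible_submodule[OF J(1)]]
    by (simp add: J Pic_one Pic_mult invertible_self)
qed (auto simp: Pic_carrier Pic_one Pic_mult invertible_self invertible_mult)

text \<open>\<open>Pic_action\<close> multiplies with \<open>class_mult R\<close>, although its
  group argument is a class over \<open>S\<close>. This is legitimate because an invertible S-ideal
  is a fractional R-ideal with the same \<open>unit_class\<close>.\<close>

lemma action_eq:
  assumes J: "invertible_ideal S J" and I: "proper_ideal I"
  shows "Pic_action R S (unit_class J) (unit_class I) = unit_class (ideal_mult J I)"
proof -
  have "unit_class I \<in> ICM_at R S"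
    unfolding ICM_at_eq using I by blast
  then show ?thesis
    using class_mult_R[OF _ fractional_S_imp_R[OF invertible_fractional[OF J]]
        proper_fractional_R[OF I]]
    unfolding Pic_action_def by simp
qed

lemma action_closed:
  assumes "X \<in> carrier (Pic S)" "Y \<in> ICM_at R S"
  shows "Pic_action R S X Y \<in> ICM_at R S"
  using assms by (auto simp: Pic_carrier ICM_at_eq action_eq intro: proper_mult)

lemma action_mult:
  assumes "X \<in> carrier (Pic S)" "X' \<in> carrier (Pic S)" "Y \<in> ICM_at R S"
  shows "Pic_action R S (X \<otimes>\<^bsub>Pic S\<^esub> X') Y = Pic_action R S X (Pic_action R S X' Y)"
  using assms
  by (auto simp: Pic_carrier ICM_at_eq action_eq Pic_mult invertible_mult proper_mult
      ideal_mult_assoc)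

lemma action_one:
  assumes "Y \<in> ICM_at R S"
  shows "Pic_action R S \<one>\<^bsub>Pic S\<^esub> Y = Y"
  using assms subring_ideal_mult[OF S_subring proper_submodule]
  by (auto simp: ICM_at_eq action_eq Pic_one invertible_self)

lemma action_Bij:
  assumes X: "X \<in> carrier (Pic S)"
  shows "Pic_action R S X \<in> Bij (ICM_at R S)"
proof -
  interpret Pic: group "Pic S" by (rule Pic_group)
  have X': "inv\<^bsub>Pic S\<^esub> X \<in> carrier (Pic S)"
    using X by simp
  have "bij_betw (Pic_action R S X) (ICM_at R S) (ICM_at R S)"
    by (rule bij_betw_byWitness[of _ "Pic_action R S (inv\<^bsub>Pic S\<^esub> X)"])
      (auto simp: action_mult[OF X X', symmetric] action_mult[OF X' X, symmetric] X action_one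
        intro: action_closed X')
  then show ?thesis
    unfolding Bij_def by (simp add: Pic_action_def)
qed

lemma Pic_group_action: "group_action (Pic S) (ICM_at R S) (Pic_action R S)"
proof (intro group_action.intro group_hom.intro group_hom_axioms.intro Pic_group group_BijGroup
    homI)
  show "Pic_action R S X \<in> carrier (BijGroup (ICM_at R S))" if "X \<in> carrier (Pic S)" for X
    using action_Bij[OF that] by (simp add: BijGroup_def)
  show "Pic_action R S (X \<otimes>\<^bsub>Pic S\<^esub> X') =
      Pic_action R S X \<otimes>\<^bsub>BijGroup (ICM_at R S)\<^esub> Pic_action R S X'"
    if X: "X \<in> carrier (Pic S)" "X' \<in> carrier (Pic S)" for X X'
  proof -
    have "Pic_action R S (X \<otimes>\<^bsub>Pic S\<^esub> X') =
        compose (ICM_at R S) (Pic_action R S X) (Pic_action R S X')"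
      \<comment> \<open>Both sides are undefined outside \<open>ICM_at R S\<close>, so agreement on
        that set suffices.\<close>
      by (rule extensionalityI[of _ "ICM_at R S"])
        (simp_all add: action_mult[OF X] compose_eq, simp_all add: Pic_action_def compose_def)
    then show ?thesis
      using action_Bij X by (simp add: BijGroup_def)
  qed
qed

sublocale Pic_action: group_action "Pic S" "ICM_at R S" "Pic_action R S"
  by (rule Pic_group_action)

lemma stabilizer_trivial:
  assumes "Y \<in> ICM_at R S"
  shows "stabilizer (Pic S) (Pic_action R S) Y = {\<one>\<^bsub>Pic S\<^esub>}"
proof
  show "{\<one>\<^bsub>Pic S\<^esub>} \<subseteq> stabilizer (Pic S) (Pic_action R S) Y"
    using Pic_action.stabilizer_one_closed[OF assms] by simp
  obtain I where I: "proper_ideal I" "Y = unit_class I"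
    using assms unfolding ICM_at_eq by blast
  show "stabilizer (Pic S) (Pic_action R S) Y \<subseteq> {\<one>\<^bsub>Pic S\<^esub>}"
  proof
    fix X assume X: "X \<in> stabilizer (Pic S) (Pic_action R S) Y"
    then obtain J where J: "invertible_ideal S J" "X = unit_class J"
      unfolding stabilizer_def Pic_carrier by blast
    \<comment> \<open>The fixed class of I is written as that of SI, so that I can be cancelled
      against the invertible ideal \<open>S\<close>.\<close>
    have "unit_class (ideal_mult J I) = unit_class (ideal_mult S I)"
      using X subring_ideal_mult[OF S_subring proper_submodule[OF I(1)]]
      by (simp add: stabilizer_def I J action_eq)
    then show "X \<in> {\<one>\<^bsub>Pic S\<^esub>}"
      using unit_class_cancel[OF J(1) invertible_self I(1)] by (simp add: J(2) Pic_one)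
  qed
qed

section \<open>Orbits and weak equivalence classes\<close>

lemma orbit_eq:
  assumes I: "proper_ideal I"
  shows "orbit (Pic S) (Pic_action R S) (unit_class I) =
    {unit_class (ideal_mult J I) | J. invertible_ideal S J}"
  using action_eq[OF _ I] unfolding orbit_def Pic_carrier by (auto; metis)

text \<open>An orbit consists of isomorphism classes, a weak class of ideals; the union bridges the
  two levels. Its members a(JI) are again of the form (aJ)I with aJ invertible.\<close>

lemma Union_orbit:
  assumes I: "proper_ideal I"
  shows "\<Union> (orbit (Pic S) (Pic_action R S) (unit_class I)) = weak_class R I"
proof -
  show ?thesis
    unfolding orbit_eq[OF I] weak_class_eq[OF I]
  proof
    show "\<Union> {unit_class (ideal_mult J I) | J. invertible_ideal S J}
      \<subseteq> {ideal_mult J I | J. invertible_ideal S J}"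
    proof
      fix I' assume "I' \<in> \<Union> {unit_class (ideal_mult J I) | J. invertible_ideal S J}"
      then obtain J where J: "invertible_ideal S J" and "I' \<in> unit_class (ideal_mult J I)"
        by blast
      then obtain a where a: "a dvd 1" "I' = (*) a ` ideal_mult J I"
        using unit_classE by blast
      have "I' = ideal_mult ((*) a ` J) I"
        by (simp add: a(2) ideal_mult_scale)
      then show "I' \<in> {ideal_mult J I | J. invertible_ideal S J}"
        using invertible_scale[OF J a(1)] by blast
    qed
    show "{ideal_mult J I | J. invertible_ideal S J}
      \<subseteq> \<Union> {unit_class (ideal_mult J I) | J. invertible_ideal S J}"
      using unit_class_self by blast
  qed
qed

text \<open>Equal orbits have equal unions. Conversely, an ideal weakly equivalent to I has the form
  JI, so its class lies in two orbits at once, and orbits that meet coincide.\<close>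

lemma orbit_eq_iff:
  assumes I: "proper_ideal I" and I': "proper_ideal I'"
  shows "orbit (Pic S) (Pic_action R S) (unit_class I) =
      orbit (Pic S) (Pic_action R S) (unit_class I') \<longleftrightarrow>
    weak_class R I = weak_class R I'"
proof
  show "weak_class R I = weak_class R I'"
    if "orbit (Pic S) (Pic_action R S) (unit_class I) =
      orbit (Pic S) (Pic_action R S) (unit_class I')"
    using that Union_orbit I I' by metis
next
  assume "weak_class R I = weak_class R I'"
  then have "I' \<in> weak_class R I"
    using I' weakly_equivalent_refl proper_fractional_R unfolding weak_class_def by blast
  then have mem: "unit_class I' \<in> orbit (Pic S) (Pic_action R S) (unit_class I)"
    unfolding orbit_eq[OF I] weak_class_eq[OF I] by blast
  have E: "unit_class I \<in> ICM_at R S" "unit_class I' \<in> ICM_at R S"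
    using I I' unfolding ICM_at_eq by auto
  then have "orbit (Pic S) (Pic_action R S) (unit_class I) \<in>
      orbits (Pic S) (ICM_at R S) (Pic_action R S)"
    "orbit (Pic S) (Pic_action R S) (unit_class I') \<in>
      orbits (Pic S) (ICM_at R S) (Pic_action R S)"
    unfolding orbits_def by auto
  then show "orbit (Pic S) (Pic_action R S) (unit_class I) =
      orbit (Pic S) (Pic_action R S) (unit_class I')"
    using Pic_action.disjoint_union mem Pic_action.orbit_refl[OF E(2)] by blast
qed

text \<open>The precise form of the identification of \<open>W_at R S\<close> with the quotient of
  \<open>ICM_at R S\<close> by \<open>Pic S\<close>.\<close>

lemma Union_bij_betw_orbits:
  "bij_betw Union (orbits (Pic S) (ICM_at R S) (Pic_action R S)) (W_at R S)"
proof -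
  have orbits: "orbits (Pic S) (ICM_at R S) (Pic_action R S) =
      (\<lambda>I. orbit (Pic S) (Pic_action R S) (unit_class I)) ` {I. proper_ideal I}"
    unfolding orbits_def ICM_at_eq by blast
  show ?thesis
    unfolding bij_betw_def
  proof
    show "inj_on Union (orbits (Pic S) (ICM_at R S) (Pic_action R S))"
    proof (rule inj_onI)
      fix X Y
      assume "X \<in> orbits (Pic S) (ICM_at R S) (Pic_action R S)"
        and "Y \<in> orbits (Pic S) (ICM_at R S) (Pic_action R S)" and eq: "\<Union> X = \<Union> Y"
      then obtain I I' where "proper_ideal I" "X = orbit (Pic S) (Pic_action R S) (unit_class I)"
        and "proper_ideal I'" "Y = orbit (Pic S) (Pic_action R S) (unit_class I')"
        unfolding orbits by blast
      then show "X = Y"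
        using eq by (simp add: Union_orbit orbit_eq_iff)
    qed
    show "\<Union> ` orbits (Pic S) (ICM_at R S) (Pic_action R S) = W_at R S"
      unfolding orbits W_at_eq image_image by (rule image_cong) (simp_all add: Union_orbit)
  qed
qed

lemma representatives:
  fixes r s :: nat
  assumes I: "\<forall>i\<in>{1..r}. fractional_ideal R (I i)"
    and J: "\<forall>j\<in>{1..s}. fractional_ideal S (J j)"
    and W: "W_at R S = {weak_class R (I i) | i. i \<in> {1..r}}"
    and P: "carrier (Pic S) = {iso_class S (J j) | j. j \<in> {1..s}}"
    and I_inj: "\<forall>i\<in>{1..r}. \<forall>i'\<in>{1..r}. i \<noteq> i' \<longrightarrow> \<not> weakly_equivalent (I i) (I i')"
    and J_inj: "\<forall>j\<in>{1..s}. \<forall>j'\<in>{1..s}. j \<noteq> j' \<longrightarrow> \<not> ideal_iso S (J j) (J j')"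
  shows "ICM_at R S =
      {iso_class R (ideal_mult (I i) (J j)) | i j. i \<in> {1..r} \<and> j \<in> {1..s}}"
    and "\<forall>i\<in>{1..r}. \<forall>i'\<in>{1..r}. \<forall>j\<in>{1..s}. \<forall>j'\<in>{1..s}. (i, j) \<noteq> (i', j') \<longrightarrow>
      \<not> ideal_iso R (ideal_mult (I i) (J j)) (ideal_mult (I i') (J j'))"
proof -
  \<comment> \<open>Each I i is weakly equivalent to some ideal with multiplicator ring
    \<open>S\<close>, and weak equivalence preserves that ring.\<close>
  have I_proper: "proper_ideal (I i)" if i: "i \<in> {1..r}" for i
  proof -
    have "weak_class R (I i) \<in> W_at R S"
      using i W by blast
    then obtain A where A: "proper_ideal A" "weak_class R (I i) = weak_class R A"
      unfolding W_at_eq by blast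
    then have "weakly_equivalent A (I i)"
      using weak_class_eq_iff I i proper_fractional_R weakly_equivalent_sym by blast
    then show ?thesis
      using weakly_equivalent_proper A(1) I i by blast
  qed
  \<comment> \<open>A class in \<open>Pic S\<close> contains an invertible ideal, and J j is a unit
    multiple of it.\<close>
  have J_invertible: "invertible_ideal S (J j)" if j: "j \<in> {1..s}" for j
  proof -
    have "unit_class (J j) \<in> carrier (Pic S)"
      using j P iso_class_S J by blast
    then obtain A where A: "invertible_ideal S A" "unit_class A = unit_class (J j)"
      unfolding Pic_carrier by blast
    then have "J j \<in> unit_class A"
      using unit_class_eq_iff by blast
    then show ?thesis
      using invertible_scale[OF A(1)] by (auto elim: unit_classE)
  qed
  have prod: "proper_ideal (ideal_mult (I i) (J j))" if "i \<in> {1..r}" "j \<in> {1..s}" for i j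
    using proper_mult[OF J_invertible I_proper] that by (simp add: ideal_mult_commute)
  have prod_class: "iso_class R (ideal_mult (I i) (J j)) = unit_class (ideal_mult (J j) (I i))"
    if "i \<in> {1..r}" "j \<in> {1..s}" for i j
    using iso_class_R[OF proper_fractional_R[OF prod[OF that]]]
    by (simp add: ideal_mult_commute)
  show "ICM_at R S =
      {iso_class R (ideal_mult (I i) (J j)) | i j. i \<in> {1..r} \<and> j \<in> {1..s}}" (is "_ = ?P")
  proof
    show "?P \<subseteq> ICM_at R S"
      using prod iso_class_R proper_fractional_R unfolding ICM_at_eq by blast
    show "ICM_at R S \<subseteq> ?P"
    proof
      fix Y assume "Y \<in> ICM_at R S"
      then obtain A where A: "proper_ideal A" "Y = unit_class A"
        unfolding ICM_at_eq by blast
      \<comment> \<open>The weak class of A determines i; the invertible ideal L with A = L (I i)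
        then determines j.\<close>
      have "weak_class R A \<in> W_at R S"
        using A(1) unfolding W_at_eq by blast
      then obtain i where i: "i \<in> {1..r}" "weak_class R A = weak_class R (I i)"
        unfolding W by blast
      then have "weakly_equivalent A (I i)"
        using weak_class_eq_iff proper_fractional_R A(1) I_proper by blast
      then obtain L where L: "invertible_ideal S L" "A = ideal_mult L (I i)"
        using weakly_equivalent_imp_mult I_proper i(1) A(1) by metis
      have "unit_class L \<in> carrier (Pic S)"
        using L(1) unfolding Pic_carrier by blast
      then obtain j where j: "j \<in> {1..s}" "unit_class L = unit_class (J j)"
        using P J iso_class_S by auto
      \<comment> \<open>The action depends only on the class, so L may be exchanged for the listed
        representative J j.\<close>
      have LJ: "Pic_action R S (unit_class L) (unit_class (I i)) =
          Pic_action R S (unit_class (J j)) (unit_class (I i))"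
        unfolding j(2) ..
      have "Y = unit_class (ideal_mult (J j) (I i))"
        using LJ unfolding A(2) L(2) action_eq[OF L(1) I_proper[OF i(1)]]
          action_eq[OF J_invertible[OF j(1)] I_proper[OF i(1)]] .
      then show "Y \<in> ?P"
        using prod_class i(1) j(1) by blast
    qed
  qed
  show "\<forall>i\<in>{1..r}. \<forall>i'\<in>{1..r}. \<forall>j\<in>{1..s}. \<forall>j'\<in>{1..s}. (i, j) \<noteq> (i', j') \<longrightarrow>
      \<not> ideal_iso R (ideal_mult (I i) (J j)) (ideal_mult (I i') (J j'))"
  proof (intro ballI impI notI)
    fix i i' j j'
    assume ii: "i \<in> {1..r}" "i' \<in> {1..r}" and jj: "j \<in> {1..s}" "j' \<in> {1..s}"
      and ne: "(i, j) \<noteq> (i', j')"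
      and iso: "ideal_iso R (ideal_mult (I i) (J j)) (ideal_mult (I i') (J j'))"
    have "ideal_mult (I i') (J j') \<in> unit_class (ideal_mult (I i) (J j))"
      using iso ideal_iso_iff[OF order] prod ii jj proper_fractional_R by blast
    then have eq: "unit_class (ideal_mult (J j) (I i)) = unit_class (ideal_mult (J j') (I i'))"
      unfolding unit_class_eq_iff by (simp add: ideal_mult_commute)
    \<comment> \<open>Multiplying by invertible ideals or units keeps the weak class, so an
      isomorphism of the products first forces i = i'; cancelling I i then forces j = j'.\<close>
    obtain a where a: "a dvd 1" "ideal_mult (J j') (I i') = (*) a ` ideal_mult (J j) (I i)"
      using eq unit_classE unfolding unit_class_eq_iff by blast
    have "weakly_equivalent (ideal_mult ((*) a ` J j) (I i)) (I i)"
      using ii jj a(1) by (intro weakly_equivalent_mult invertible_scale J_invertible I_proper)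
    then have "weakly_equivalent (ideal_mult (J j') (I i')) (I i)"
      by (simp add: a(2) ideal_mult_scale)
    then have "weakly_equivalent (I i) (I i')"
      using weakly_equivalent_mult[OF J_invertible[OF jj(2)] I_proper[OF ii(2)]]
        weakly_equivalent_sym weakly_equivalent_trans by blast
    then have i_eq: "i = i'"
      using I_inj ii by blast
    then have "unit_class (J j) = unit_class (J j')"
      using unit_class_cancel eq J_invertible I_proper ii jj by blast
    then have "ideal_iso S (J j) (J j')"
      using ideal_iso_iff[OF order _ _ R_subset_S] fractional_S_imp_R J jj unit_class_eq_iff
      by blast
    then show False
      using J_inj jj ne i_eq by blast
  qed
qed

end

theorem theorem4p6:
  fixes R S :: "'k::comm_ring_1 set"
  assumes "is_order R" and "over_order R S"
  shows
    "group_action (Pic S) (ICM_at R S) (Pic_action R S) \<and>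
     (\<forall>Y\<in>ICM_at R S. stabilizer (Pic S) (Pic_action R S) Y = {\<one>\<^bsub>Pic S\<^esub>}) \<and>
     (\<forall>I I'. fractional_ideal R I \<and> multiplicator_ring I = S \<and>
             fractional_ideal R I' \<and> multiplicator_ring I' = S \<longrightarrow>
        (orbit (Pic S) (Pic_action R S) (iso_class R I) =
           orbit (Pic S) (Pic_action R S) (iso_class R I')
         \<longleftrightarrow> weak_class R I = weak_class R I')) \<and>
     bij_betw Union (orbits (Pic S) (ICM_at R S) (Pic_action R S)) (W_at R S) \<and>
     (\<forall>(r::nat) (s::nat) I J.
        (\<forall>i\<in>{1..r}. fractional_ideal R (I i)) \<and>
        (\<forall>j\<in>{1..s}. fractional_ideal S (J j)) \<and>
        W_at R S = {weak_class R (I i) | i. i \<in> {1..r}} \<and>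
        carrier (Pic S) = {iso_class S (J j) | j. j \<in> {1..s}} \<and>
        (\<forall>i\<in>{1..r}. \<forall>i'\<in>{1..r}. i \<noteq> i' \<longrightarrow> \<not> weakly_equivalent (I i) (I i')) \<and>
        (\<forall>j\<in>{1..s}. \<forall>j'\<in>{1..s}. j \<noteq> j' \<longrightarrow> \<not> ideal_iso S (J j) (J j')) \<longrightarrow>
        ICM_at R S =
          {iso_class R (ideal_mult (I i) (J j)) | i j. i \<in> {1..r} \<and> j \<in> {1..s}} \<and>
        (\<forall>i\<in>{1..r}. \<forall>i'\<in>{1..r}. \<forall>j\<in>{1..s}. \<forall>j'\<in>{1..s}. (i, j) \<noteq> (i', j') \<longrightarrow>
           \<not> ideal_iso R (ideal_mult (I i) (J j)) (ideal_mult (I i') (J j'))))"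
proof -
  interpret order_extension R S
    using assms by unfold_locales
  show ?thesis
  proof (intro conjI allI impI, goal_cases)
    case 1
    show ?case by (rule Pic_group_action)
  next
    case 2
    show ?case using stabilizer_trivial by blast
  next
    case (3 I I')
    then show ?case
      using orbit_eq_iff[of I I'] by (simp add: iso_class_R proper_ideal_def)
  next
    case 4
    show ?case by (rule Union_bij_betw_orbits)
  next
    case (5 r s I J)
    then show ?case by (elim conjE) (rule representatives(1))
  next
    case (6 r s I J)
    then show ?case by (elim conjE) (rule representatives(2))
  qed
qed

end
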